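(* Let $(V,\omega)$ be a symplectic real vector space of dimension $2n$ with a fixed basis. If $L\in\mathfrak{sp}_{\omega}(n;\mathbb{R})$, then there exists a family of $\omega$-Hamiltonian vector fields $X:V\to V$, each satisfying $dX_0=L$.
   Context: A symplectic vector space $(V,\omega)$ is a finite-dimensional real vector space $V$ (of even dimension $2n$) with an alternating non-degenerate bilinear form $\omega:V\times V\to\mathbb{R}$. A (not necessarily symplectic) basis of $V$ is fixed, vectors are identified with their coordinate columns, and $[\omega]\in\mathbb{M}_{2n}(\mathbb{R})$ is the (skew-symmetric, invertible) matrix of $\omega$ in this basis, so $\omega(\mathbf u,\mathbf v)=\mathbf u^T[\omega]\mathbf v$. A vector field $X:V\to V$ is $\omega$-Hamiltonian if there is a smooth function $H:V\to\mathbb{R}$ such that $\omega(X(x),\cdot)=dH_x$ for all $x\in V$; equivalently $X(x)=([\omega]^{-1})^T\nabla H(x)$, where $\nabla H$ is the column of partial derivatives of $H$ in the fixed basis. $\mathfrak{sp}_{\omega}(n;\mathbb{R})=\{L\in\mathbb{M}_{2n}(\mathbb{R}): L^T[\omega]+[\omega]L=0\}$. The symbol $dX_0$ denotes the matrix, in the fixed basis, of the derivative of $X$ at $0$. A family means a non-empty collection. *)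

theory Defs
  imports "HOL-Analysis.Analysis"
begin

text \<open>
  A finite-dimensional real vector space is a type of class \<open>euclidean_space\<close>. The class only supplies
  the (norm-independent) topology used for derivatives; its inner product and its standard basis
  play no role in the definitions below.
\<close>

definition symplectic_form :: "('v::euclidean_space \<Rightarrow> 'v \<Rightarrow> real) \<Rightarrow> bool" where
  "symplectic_form \<omega> \<longleftrightarrow>
     bilinear \<omega> \<and> (\<forall>u. \<omega> u u = 0) \<and> (\<forall>u. (\<forall>v. \<omega> u v = 0) \<longrightarrow> u = 0)"

definition indexed_basis :: "('m::finite \<Rightarrow> 'v::euclidean_space) \<Rightarrow> bool" where
  "indexed_basis b \<longleftrightarrow> inj b \<and> independent (range b) \<and> span (range b) = UNIV"

definition form_matrix :: "('m::finite \<Rightarrow> 'v) \<Rightarrow> ('v::euclidean_space \<Rightarrow> 'v \<Rightarrow> real) \<Rightarrow> real^'m^'m" where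
  "form_matrix b \<omega> = (\<chi> i j. \<omega> (b i) (b j))"

text \<open>Column \<open>j\<close> consists of the coordinates of \<open>f (b j)\<close> with respect to \<open>b\<close>.\<close>

definition endo_matrix :: "('m::finite \<Rightarrow> 'v) \<Rightarrow> ('v::euclidean_space \<Rightarrow> 'v) \<Rightarrow> real^'m^'m" where
  "endo_matrix b f = (\<chi> i j. representation (range b) (f (b j)) (b i))"

definition sp :: "('m::finite \<Rightarrow> 'v) \<Rightarrow> ('v::euclidean_space \<Rightarrow> 'v \<Rightarrow> real) \<Rightarrow> (real^'m^'m) set" where
  "sp b \<omega> = {L. transpose L ** form_matrix b \<omega> + form_matrix b \<omega> ** L = 0}"

text \<open>
  In finite dimension \<open>f\<close> is of class $C^{k+1}$ iff it is differentiable and all its directional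
  derivatives are of class $C^k$.
\<close>

primrec C_class :: "nat \<Rightarrow> ('v::euclidean_space \<Rightarrow> real) \<Rightarrow> bool" where
  "C_class 0 f \<longleftrightarrow> continuous_on UNIV f"
| "C_class (Suc k) f \<longleftrightarrow>
     (\<forall>x. f differentiable (at x)) \<and> (\<forall>v. C_class k (\<lambda>x. frechet_derivative f (at x) v))"

definition smooth :: "('v::euclidean_space \<Rightarrow> real) \<Rightarrow> bool" where
  "smooth f \<longleftrightarrow> (\<forall>k. C_class k f)"

definition hamiltonian_vector_field ::
    "('v::euclidean_space \<Rightarrow> 'v \<Rightarrow> real) \<Rightarrow> ('v \<Rightarrow> 'v) \<Rightarrow> bool" where
  "hamiltonian_vector_field \<omega> X \<longleftrightarrow>
     (\<exists>H. smooth H \<and> (\<forall>x. (H has_derivative \<omega> (X x)) (at x)))"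

end

theory Submission
  imports Defs
begin

text \<open>
  The linear vector field with matrix \<open>L\<close> does the job. The condition defining \<open>sp\<close> says that
  \<open>(u, v) \<mapsto> \<omega> (X u) v\<close> is symmetric, hence it is the polarisation of the quadratic Hamiltonian
  \<open>H x = \<omega> (X x) x / 2\<close>.
\<close>

lemma C_class_const: "C_class k (\<lambda>x. c)"
  by (induction k arbitrary: c) (simp_all add: frechet_derivative_const)

text \<open>A linear map is its own derivative at every point, so each directional derivative is
  constant in \<open>x\<close>. A case split on \<open>k\<close> therefore replaces an
  induction.\<close>

lemma C_class_linear:
  assumes "linear f"
  shows "C_class k f"
proof (cases k)
  case 0
  then show ?thesis
    using assms by (simp add: linear_continuous_on linear_linear)
next
  case (Suc k')
  have "(f has_derivative f) (at x)" for x
    using assms by (simp add: bounded_linear_imp_has_derivative linear_linear)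
  moreover from this have "frechet_derivative f (at x) = f" for x
    by (metis frechet_derivative_at)
  ultimately show ?thesis
    unfolding Suc by (auto simp: differentiable_def C_class_const)
qed

text \<open>The product rule yields \<open>B x h + B h x\<close>; by symmetry the two terms
  coincide, and the factor 1/2 cancels the resulting 2.\<close>

lemma has_derivative_quadratic:
  fixes B :: "'v::euclidean_space \<Rightarrow> 'v \<Rightarrow> real"
  assumes "bilinear B" and "\<And>u v. B u v = B v u"
  shows "((\<lambda>x. B x x / 2) has_derivative B x) (at x)"
proof -
  have "bounded_bilinear B"
    using assms(1) bilinear_conv_bounded_bilinear by blast
  from bounded_bilinear.FDERIV[OF this has_derivative_ident has_derivative_ident]
  have "((\<lambda>x. B x x) has_derivative (\<lambda>h. B x h + B h x)) (at x)" .
  then have "((\<lambda>x. B x x / 2) has_derivative (\<lambda>h. (B x h + B h x) / 2)) (at x)"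
    by (auto intro!: derivative_eq_intros)
  moreover have "(\<lambda>h. (B x h + B h x) / 2) = B x"
  proof
    show "(B x h + B h x) / 2 = B x h" for h
      by (simp add: assms(2)[of h x])
  qed
  ultimately show ?thesis by simp
qed

lemma smooth_quadratic:
  fixes B :: "'v::euclidean_space \<Rightarrow> 'v \<Rightarrow> real"
  assumes "bilinear B" and "\<And>u v. B u v = B v u"
  shows "smooth (\<lambda>x. B x x / 2)"
  unfolding smooth_def
proof
  fix k
  note der = has_derivative_quadratic[OF assms]
  show "C_class k (\<lambda>x. B x x / 2)"
  proof (cases k)
    case 0
    then show ?thesis
      using has_derivative_continuous[OF der] by (simp add: continuous_on_eq_continuous_at)
  next
    case (Suc k')
    have "frechet_derivative (\<lambda>x. B x x / 2) (at x) = B x" for x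
      using der by (metis frechet_derivative_at)
    \<comment> \<open>The derivative in direction \<open>v\<close> is linear in the base point, so
      one differentiation reduces smoothness to the linear case.\<close>
    moreover have "C_class k' (\<lambda>x. B x v)" for v
      using assms(1) by (simp add: C_class_linear bilinear_def)
    ultimately show ?thesis
      unfolding Suc using der by (auto simp: differentiable_def)
  qed
qed

text \<open>With \<open>B u = \<omega> (X u)\<close>, the derivative \<open>B x\<close> of the
  quadratic form at \<open>x\<close> is literally the functional that a Hamiltonian for
  \<open>X\<close> must have.\<close>

lemma hamiltonian_linear:
  assumes "bilinear \<omega>" and "linear X" and "\<And>u v. \<omega> (X u) v = \<omega> (X v) u"
  shows "hamiltonian_vector_field \<omega> X"
proof -
  have "bilinear (\<lambda>u. \<omega> (X u))"
    using assms(1,2) linear_compose[of X]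
    by (fastforce simp: bilinear_def o_def)
  from smooth_quadratic[OF this assms(3)] has_derivative_quadratic[OF this assms(3)]
  show ?thesis
    unfolding hamiltonian_vector_field_def by blast
qed

lemma symplectic_form_skew:
  assumes "symplectic_form \<omega>"
  shows "\<omega> u v = - \<omega> v u"
proof -
  have bil: "bilinear \<omega>" and alt: "\<And>u. \<omega> u u = 0"
    using assms by (auto simp: symplectic_form_def)
  show ?thesis
    \<comment> \<open>Expanding \<open>\<omega> (u + v) (u + v) = 0\<close> leaves only the two
      mixed terms.\<close>
    using alt[of "u + v"] alt[of u] alt[of v]
    by (simp add: bilinear_ladd[OF bil] bilinear_radd[OF bil])
qed

text \<open>Values on a basis can be prescribed freely, so column \<open>j\<close> of
  \<open>L\<close> dictates the image of \<open>b j\<close>. These values are exported along with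
  the matrix because the symmetry argument computes with them.\<close>

lemma linear_with_endo_matrix:
  fixes b :: "'m::finite \<Rightarrow> 'v::euclidean_space"
  assumes "indexed_basis b"
  obtains X where "linear X" and "\<And>j. X (b j) = (\<Sum>i\<in>UNIV. L $ i $ j *\<^sub>R b i)"
    and "endo_matrix b X = L"
proof -
  have inj: "inj b" and ind: "independent (range b)"
    using assms by (auto simp: indexed_basis_def)
  obtain X where lin: "linear X"
    \<comment> \<open>The extension theorem takes a function of vectors, so \<open>inv b\<close>
      recovers the column index from a basis vector.\<close>
    and "\<forall>v\<in>range b. X v = (\<Sum>i\<in>UNIV. L $ i $ inv b v *\<^sub>R b i)"
    using linear_independent_extend[OF ind, where f = "\<lambda>v. \<Sum>i\<in>UNIV. L $ i $ inv b v *\<^sub>R b i"]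
    by blast
  then have X: "X (b j) = (\<Sum>i\<in>UNIV. L $ i $ j *\<^sub>R b i)" for j
    by (simp add: inv_f_f[OF inj])
  have "representation (range b) (X (b j)) (b i) = L $ i $ j" for i j
  proof -
    have "representation (range b) (X (b j)) (b i) =
        (\<Sum>k\<in>UNIV. L $ k $ j * representation (range b) (b k) (b i))"
      by (simp add: X representation_sum[OF ind] representation_scale[OF ind] span_base span_scale)
    also have "\<dots> = (\<Sum>k\<in>UNIV. if k = i then L $ k $ j else 0)"
      by (intro sum.cong) (auto simp: representation_basis[OF ind] inj_eq[OF inj])
    finally show ?thesis by simp
  qed
  then have "endo_matrix b X = L"
    by (simp add: endo_matrix_def vec_eq_iff)
  with lin X show thesis by (rule that)
qed

text \<open>On basis vectors the two products in the definition of \<open>sp\<close> have entries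
  \<open>\<omega> (X (b i)) (b j)\<close> and \<open>\<omega> (b i) (X (b j))\<close>. Their sum
  vanishes, and skew-symmetry of \<open>\<omega>\<close> turns this sign change into
  symmetry.\<close>

lemma sp_imp_symmetric:
  fixes b :: "'m::finite \<Rightarrow> 'v::euclidean_space"
  assumes \<omega>: "symplectic_form \<omega>" and b: "indexed_basis b" and L: "L \<in> sp b \<omega>"
    and lin: "linear X" and X: "\<And>j. X (b j) = (\<Sum>i\<in>UNIV. L $ i $ j *\<^sub>R b i)"
  shows "\<omega> (X u) v = \<omega> (X v) u"
proof -
  have bil: "bilinear \<omega>"
    using \<omega> by (simp add: symplectic_form_def)
  have basis: "\<omega> (X (b i)) (b j) = \<omega> (X (b j)) (b i)" for i j
  proof -
    have "\<omega> (X (b i)) (b j) = (transpose L ** form_matrix b \<omega>) $ i $ j"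
      using bil
      by (simp add: X bilinear_def linear_sum[of "\<lambda>u. \<omega> u (b j)"] linear_cmul[of "\<lambda>u. \<omega> u (b j)"]
          matrix_matrix_mult_def transpose_def form_matrix_def)
    also have "\<dots> = - (form_matrix b \<omega> ** L) $ i $ j"
      using L by (simp add: sp_def vec_eq_iff eq_neg_iff_add_eq_0)
    also have "\<dots> = - \<omega> (b i) (X (b j))"
      using bil
      by (simp add: X bilinear_def linear_sum[of "\<omega> (b i)"] linear_cmul[of "\<omega> (b i)"]
          matrix_matrix_mult_def form_matrix_def mult.commute)
    also have "\<dots> = \<omega> (X (b j)) (b i)"
      using symplectic_form_skew[OF \<omega>, of "X (b j)" "b i"] by linarith
    finally show ?thesis .
  qed
  \<comment> \<open>Both sides are bilinear in \<open>u\<close> and \<open>v\<close>, so agreement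
    on pairs of basis vectors suffices.\<close>
  have "bilinear (\<lambda>u v. \<omega> (X u) v)" and "bilinear (\<lambda>u v. \<omega> (X v) u)"
    using bil lin linear_compose[OF lin]
    by (auto simp: bilinear_def o_def)
  then show ?thesis
    by (rule bilinear_eq[where S = UNIV and T = UNIV and B = "range b" and C = "range b"])
      (use b basis in \<open>auto simp: indexed_basis_def\<close>)
qed

theorem corollary4p7:
  fixes \<omega> :: "'v::euclidean_space \<Rightarrow> 'v \<Rightarrow> real"
    and b :: "'m::finite \<Rightarrow> 'v"
    and L :: "real^'m^'m"
    and n :: nat
  assumes "symplectic_form \<omega>"
    and "DIM('v) = 2 * n"
    and "indexed_basis b"
    and "L \<in> sp b \<omega>"
  shows "\<exists>F :: ('v \<Rightarrow> 'v) set. F \<noteq> {} \<and>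
           (\<forall>X\<in>F. hamiltonian_vector_field \<omega> X \<and>
                   X differentiable (at 0) \<and>
                   endo_matrix b (frechet_derivative X (at 0)) = L)"
proof -
  obtain X where X: "linear X" "\<And>j. X (b j) = (\<Sum>i\<in>UNIV. L $ i $ j *\<^sub>R b i)"
    and mat: "endo_matrix b X = L"
    using linear_with_endo_matrix[OF assms(3)] by blast
  have "bilinear \<omega>"
    using assms(1) by (simp add: symplectic_form_def)
  then have "hamiltonian_vector_field \<omega> X"
    using X(1) sp_imp_symmetric[OF assms(1,3,4) X] by (rule hamiltonian_linear)
  moreover have der: "(X has_derivative X) (at 0)"
    using X(1) by (simp add: bounded_linear_imp_has_derivative linear_linear)
  moreover have "frechet_derivative X (at 0) = X"
    using der by (metis frechet_derivative_at)
  ultimately show ?thesis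
    \<comment> \<open>A family need only be non-empty, so the singleton of the linear field serves
      as witness.\<close>
    using mat by (intro exI[of _ "{X}"]) (auto simp: differentiable_def)
qed

end
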